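(* Let $\mathcal M$ be a nonempty finite workflow pool, and suppose there is a function $H:[0,1]\to[0,1]$ with $H(0)=0$, $H(1)=1$, $\psi_k(r)\le H(r/k)$ for all $1\le k\le K_{\max}$, $0\le r\le k$, and $\Lambda(H)\le\Lambda<\infty$ for some $\Lambda\ge1$. Let $a^\star=\max_{g\in\mathcal M}\bar a_g$. Then: 1. If $\gamma=0$, the maximum gain over the best workflow satisfies $$\mathrm{OPT}_{\psi,0}(\mathcal M)-a^\star\le h_\Lambda(a^\star)-a^\star=\frac{(\Lambda-1)a^\star(1-a^\star)}{1+(\Lambda-1)a^\star}\le\frac{\sqrt\Lambda-1}{\sqrt\Lambda+1}.$$ 2. If every workflow has the same execution cost $c_g=c$ and $\gamma c\ge h_\Lambda(a^\star)-a^\star$, then the best nonempty portfolio is a singleton, i.e. the maximum of $\Pi_{\psi,\gamma}(\boldsymbol m)$ over nonzero $\boldsymbol m\in\mathbb Z_+^{\mathcal M}$ with $k(\boldsymbol m)\le K_{\max}$ is attained at some vector with exactly one execution. With the outside option $\boldsymbol 0$ included, the global optimum is attained either at that singleton or at $\boldsymbol 0$ (no deployment).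
   Context: Setting. There are $n\ge1$ development tasks $i=1,\dots,n$ and workflow types $g$ in a finite pool $\mathcal M$. Each pair has a correctness indicator $a_{ig}\in\{0,1\}$; each workflow has execution cost $c_g\ge0$; $\gamma\ge0$ is a cost price; $K_{\max}\ge1$ is an integer. The standalone accuracy is $\bar a_g=\frac1n\sum_{i=1}^n a_{ig}$. For $\boldsymbol m\in\mathbb Z_+^{\mathcal M}$ put $k(\boldsymbol m)=\sum_g m_g$, $r_i(\boldsymbol m)=\sum_g a_{ig}m_g$, $C(\boldsymbol m)=\sum_g c_gm_g$. Recovery curves are functions $\psi_k:\{0,1,\dots,k\}\to[0,1]$, $k=1,\dots,K_{\max}$, with $\psi_k(0)=0$ and $\psi_k(k)=1$. For $\boldsymbol m\ne\boldsymbol 0$ with $k(\boldsymbol m)\le K_{\max}$, $\Pi_{\psi,\gamma}(\boldsymbol m)=\frac1n\sum_{i=1}^n\psi_{k(\boldsymbol m)}(r_i(\boldsymbol m))-\gamma C(\boldsymbol m)$; $\Pi_{\psi,\gamma}(\boldsymbol 0)=0$. Define $\mathrm{OPT}_{\psi,\gamma}(\mathcal M)=\max\{\Pi_{\psi,\gamma}(\boldsymbol m):\boldsymbol m\in\mathbb Z_+^{\mathcal M},\ k(\boldsymbol m)\le K_{\max}\}$. Odds-lift index: $\Lambda(H)=\sup_{p\in(0,1)}\dfrac{H(p)/(1-H(p))}{p/(1-p)}$, with $\Lambda(H)=+\infty$ if $H(p)=1$ for some $p\in(0,1)$. Envelope: $h_\Lambda(p)=\dfrac{\Lambda p}{1+(\Lambda-1)p}$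 for $p\in[0,1]$. *)

theory Defs
  imports "HOL-Analysis.Analysis"
begin

text \<open>
  Tasks are the indices \<open>1..n\<close>; \<open>a i g\<close> is the correctness indicator of workflow \<open>g\<close> on task \<open>i\<close>.
  A vector of multiplicities indexed by the finite pool \<open>M\<close> is a function \<open>m :: 'g \<Rightarrow> nat\<close> that
  vanishes outside \<open>M\<close>, so that the zero vector is \<open>\<lambda>_. 0\<close>.
\<close>

definition accuracy :: "nat \<Rightarrow> (nat \<Rightarrow> 'g \<Rightarrow> nat) \<Rightarrow> 'g \<Rightarrow> real" where
  "accuracy n a g = (1 / real n) * (\<Sum>i=1..n. real (a i g))"

definition best_accuracy :: "nat \<Rightarrow> (nat \<Rightarrow> 'g \<Rightarrow> nat) \<Rightarrow> 'g set \<Rightarrow> real" where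
  "best_accuracy n a M = Max (accuracy n a ` M)"

definition executions :: "'g set \<Rightarrow> ('g \<Rightarrow> nat) \<Rightarrow> nat" where
  "executions M m = (\<Sum>g\<in>M. m g)"

definition successes :: "(nat \<Rightarrow> 'g \<Rightarrow> nat) \<Rightarrow> 'g set \<Rightarrow> ('g \<Rightarrow> nat) \<Rightarrow> nat \<Rightarrow> nat" where
  "successes a M m i = (\<Sum>g\<in>M. a i g * m g)"

definition total_cost :: "('g \<Rightarrow> real) \<Rightarrow> 'g set \<Rightarrow> ('g \<Rightarrow> nat) \<Rightarrow> real" where
  "total_cost c M m = (\<Sum>g\<in>M. c g * real (m g))"

definition portfolios :: "'g set \<Rightarrow> nat \<Rightarrow> ('g \<Rightarrow> nat) set" where
  "portfolios M K = {m. (\<forall>g. g \<notin> M \<longrightarrow> m g = 0) \<and> executions M m \<le> K}"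

definition recovery_curves :: "nat \<Rightarrow> (nat \<Rightarrow> nat \<Rightarrow> real) \<Rightarrow> bool" where
  "recovery_curves K \<psi> \<longleftrightarrow>
     (\<forall>k\<in>{1..K}. (\<forall>r\<in>{0..k}. \<psi> k r \<in> {0..1}) \<and> \<psi> k 0 = 0 \<and> \<psi> k k = 1)"

definition payoff ::
  "nat \<Rightarrow> (nat \<Rightarrow> 'g \<Rightarrow> nat) \<Rightarrow> ('g \<Rightarrow> real) \<Rightarrow> 'g set \<Rightarrow> (nat \<Rightarrow> nat \<Rightarrow> real) \<Rightarrow> real \<Rightarrow> ('g \<Rightarrow> nat) \<Rightarrow> real"
where
  "payoff n a c M \<psi> \<gamma> m =
     (if m = (\<lambda>_. 0) then 0
      else (1 / real n) * (\<Sum>i=1..n. \<psi> (executions M m) (successes a M m i)) - \<gamma> * total_cost c M m)"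

definition opt_payoff ::
  "nat \<Rightarrow> (nat \<Rightarrow> 'g \<Rightarrow> nat) \<Rightarrow> ('g \<Rightarrow> real) \<Rightarrow> 'g set \<Rightarrow> nat \<Rightarrow> (nat \<Rightarrow> nat \<Rightarrow> real) \<Rightarrow> real \<Rightarrow> real"
where
  "opt_payoff n a c M K \<psi> \<gamma> = Max (payoff n a c M \<psi> \<gamma> ` portfolios M K)"

text \<open>The maximum above ranges over a finite nonempty set.\<close>

lemma finite_portfolios:
  assumes "finite M"
  shows "finite (portfolios M K)"
proof (rule finite_subset)
  have "m g \<le> K" if "m \<in> portfolios M K" "g \<in> M" for m g
    using that member_le_sum[of g M m] assms by (simp add: portfolios_def executions_def)
  then show "portfolios M K \<subseteq> {m. \<forall>g. (g \<in> M \<longrightarrow> m g \<in> {..K}) \<and> (g \<notin> M \<longrightarrow> m g = 0)}"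
    by (auto simp: portfolios_def)
  show "finite {m. \<forall>g. (g \<in> M \<longrightarrow> m g \<in> {..K}) \<and> (g \<notin> M \<longrightarrow> m g = (0::nat))}"
    using assms by (intro finite_set_of_finite_funs) auto
qed

lemma zero_in_portfolios: "(\<lambda>_. 0) \<in> portfolios M K"
  by (simp add: portfolios_def executions_def)

text \<open>
  The first branch cannot be dropped: since \<open>x / 0 = 0\<close>, the quotient would be 0, not infinite,
  at a point where \<open>H p = 1\<close>.
\<close>

definition odds_lift :: "(real \<Rightarrow> real) \<Rightarrow> ereal" where
  "odds_lift H =
     (if \<exists>p\<in>{0<..<1}. H p = 1 then \<infinity>
      else (SUP p\<in>{0<..<1}. ereal ((H p / (1 - H p)) / (p / (1 - p)))))"

definition envelope :: "real \<Rightarrow> real \<Rightarrow> real" where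
  "envelope \<Lambda> p = \<Lambda> * p / (1 + (\<Lambda> - 1) * p)"

end

theory Submission
  imports Defs
begin

text \<open>
  The odds-lift bound says exactly that \<open>H\<close> lies below the envelope \<open>h\<close>. Since \<open>h\<close> is concave and
  increasing, it lies below its tangent at \<open>a\<^sup>*\<close>, whose slope is nonnegative. Averaging the tangent
  over the tasks gives at most \<open>h a\<^sup>*\<close>, because the mean recovery ratio of a portfolio is a
  convex combination of standalone accuracies. With equal costs, an additional execution costs at
  least the largest possible gain \<open>h a\<^sup>* - a\<^sup>*\<close>, so no larger portfolio beats the best singleton.
\<close>

section \<open>Algebra and concavity of the envelope\<close>

lemma envelope_denominator_pos:
  fixes \<Lambda> p :: real
  assumes "\<Lambda> \<ge> 1" "p \<ge> 0"
  shows "1 + (\<Lambda> - 1) * p > 0"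
  using assms mult_nonneg_nonneg[of "\<Lambda> - 1" p] by linarith

text \<open>Concavity in tangent form: the factor of \<open>x - b\<close> is the derivative of the
  envelope at \<open>b\<close>. The gap between tangent and envelope is computed explicitly and is a
  nonnegative multiple of the square of \<open>x - b\<close>, so no calculus is involved.\<close>

lemma envelope_tangent:
  fixes \<Lambda> x b :: real
  assumes "\<Lambda> \<ge> 1" "x \<ge> 0" "b \<ge> 0"
  shows "envelope \<Lambda> x \<le> envelope \<Lambda> b + \<Lambda> / (1 + (\<Lambda> - 1) * b)\<^sup>2 * (x - b)"
proof -
  let ?X = "1 + (\<Lambda> - 1) * x" and ?B = "1 + (\<Lambda> - 1) * b"
  have pos: "?X > 0" "?B > 0"
    using assms by (auto intro: envelope_denominator_pos)
  define X B where "X = ?X" and "B = ?B"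
  have "envelope \<Lambda> x - envelope \<Lambda> b = \<Lambda> * (x - b) / (X * B)"
    using pos unfolding envelope_def X_def[symmetric] B_def[symmetric]
    by (simp add: field_simps) (simp add: X_def B_def algebra_simps)
  \<comment> \<open>Both terms share the factor \<open>\<Lambda> * (x - b)\<close>; the remaining
    difference of reciprocals has numerator \<open>X - B\<close>, which equals
    \<open>(\<Lambda> - 1) * (x - b)\<close> and supplies the second factor
    \<open>x - b\<close>.\<close>
  moreover have "\<Lambda> / B\<^sup>2 * (x - b) - \<Lambda> * (x - b) / (X * B) = \<Lambda> * (\<Lambda> - 1) * (x - b)\<^sup>2 / (X * B\<^sup>2)"
  proof -
    have eq: "\<Lambda> * (\<Lambda> - 1) * (x - b)\<^sup>2 = \<Lambda> * (x - b) * (X - B)"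
      by (simp add: X_def B_def power2_eq_square algebra_simps)
    show ?thesis
      using pos unfolding eq X_def[symmetric] B_def[symmetric]
      by (simp add: field_simps power2_eq_square)
  qed
  moreover have "\<Lambda> * (\<Lambda> - 1) * (x - b)\<^sup>2 / (X * B\<^sup>2) \<ge> 0"
    using assms pos by (auto simp: X_def B_def intro!: divide_nonneg_nonneg mult_nonneg_nonneg)
  ultimately show ?thesis
    unfolding B_def[symmetric] by linarith
qed

lemma envelope_gain:
  fixes \<Lambda> p :: real
  assumes "\<Lambda> \<ge> 1" "p \<ge> 0"
  shows "envelope \<Lambda> p - p = (\<Lambda> - 1) * p * (1 - p) / (1 + (\<Lambda> - 1) * p)"
  using envelope_denominator_pos[OF assms]
  by (simp add: envelope_def divide_simps) (simp add: algebra_simps)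

lemma envelope_ge:
  fixes \<Lambda> p :: real
  assumes "\<Lambda> \<ge> 1" "p \<in> {0..1}"
  shows "p \<le> envelope \<Lambda> p"
proof -
  have "0 \<le> (\<Lambda> - 1) * p * (1 - p) / (1 + (\<Lambda> - 1) * p)"
    using assms envelope_denominator_pos[of \<Lambda> p]
    by (intro divide_nonneg_nonneg mult_nonneg_nonneg) auto
  also have "\<dots> = envelope \<Lambda> p - p"
    using assms by (intro envelope_gain[symmetric]) auto
  finally show ?thesis by simp
qed

text \<open>Equality holds at \<open>p = 1 / (sqrt \<Lambda> + 1)\<close>. With
  \<open>s = sqrt \<Lambda>\<close>, clearing denominators leaves \<open>s - 1\<close> times the
  square of \<open>1 - (s + 1) * p\<close>, which vanishes exactly there when
  \<open>s > 1\<close>.\<close>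

lemma envelope_gain_le:
  fixes \<Lambda> p :: real
  assumes "\<Lambda> \<ge> 1" "p \<ge> 0"
  shows "(\<Lambda> - 1) * p * (1 - p) / (1 + (\<Lambda> - 1) * p) \<le> (sqrt \<Lambda> - 1) / (sqrt \<Lambda> + 1)"
proof -
  define s where "s = sqrt \<Lambda>"
  have s: "s \<ge> 1" "\<Lambda> = s\<^sup>2"
    using assms by (auto simp: s_def)
  have "(s - 1) * (1 + (s\<^sup>2 - 1) * p) - (s\<^sup>2 - 1) * p * (1 - p) * (s + 1)
      = (s - 1) * (1 - (s + 1) * p)\<^sup>2"
    by (simp add: power2_eq_square algebra_simps)
  moreover have "(s - 1) * (1 - (s + 1) * p)\<^sup>2 \<ge> 0"
    using s by simp
  ultimately have "(s\<^sup>2 - 1) * p * (1 - p) * (s + 1) \<le> (s - 1) * (1 + (s\<^sup>2 - 1) * p)"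
    by linarith
  then show ?thesis
    using envelope_denominator_pos[OF assms] s unfolding s_def[symmetric]
    by (simp add: frac_le_eq divide_simps)
qed

text \<open>Inside the unit interval this is the odds inequality solved for \<open>H p\<close>. At
  the endpoints, which the supremum does not see, the prescribed values of \<open>H\<close> agree
  with those of the envelope.\<close>

lemma odds_lift_le_envelope:
  assumes "H \<in> {0..1} \<rightarrow> {0..1}" "H 0 = 0" "H 1 = 1"
    and lift: "odds_lift H \<le> ereal \<Lambda>" and "\<Lambda> \<ge> 1" and p: "p \<in> {0..1}"
  shows "H p \<le> envelope \<Lambda> p"
proof (cases "p = 0 \<or> p = 1")
  case True
  then show ?thesis
    using assms by (auto simp: envelope_def)
next
  case False
  with p have p01: "p \<in> {0<..<1}" by auto
  \<comment> \<open>A finite bound excludes the infinite branch, so \<open>H p < 1\<close> and the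
    odds of \<open>H p\<close> are a genuine quotient.\<close>
  have ne: "\<not> (\<exists>q\<in>{0<..<1}. H q = 1)"
    using lift by (auto simp: odds_lift_def split: if_splits)
  have "H p \<le> 1" "H p \<noteq> 1"
    using assms(1) p p01 ne by auto
  then have Hp: "1 - H p > 0" by auto
  have "ereal ((H p / (1 - H p)) / (p / (1 - p))) \<le> odds_lift H"
    unfolding odds_lift_def if_not_P[OF ne] using p01 by (rule SUP_upper)
  then have "(H p / (1 - H p)) / (p / (1 - p)) \<le> \<Lambda>"
    using lift order_trans ereal_less_eq(3) by blast
  moreover have "p / (1 - p) > 0"
    using p01 by simp
  ultimately have "H p / (1 - H p) \<le> \<Lambda> * (p / (1 - p))"
    by (simp only: pos_divide_le_eq)
  then have "H p * (1 - p) \<le> \<Lambda> * p * (1 - H p)"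
    using Hp p01 by (simp add: field_simps)
  \<comment> \<open>Collecting the terms in \<open>H p\<close> produces the denominator of the
    envelope.\<close>
  then have "H p * (1 + (\<Lambda> - 1) * p) \<le> \<Lambda> * p"
    by (simp add: algebra_simps)
  then show ?thesis
    using envelope_denominator_pos[of \<Lambda> p] assms(5) p
    by (simp add: envelope_def pos_le_divide_eq)
qed

section \<open>Accuracies, execution counts and averages over tasks\<close>

lemma accuracy_le_best:
  assumes "finite M" "g \<in> M"
  shows "accuracy n a g \<le> best_accuracy n a M"
  using assms by (simp add: best_accuracy_def)

lemma best_accuracy_attained:
  assumes "finite M" "M \<noteq> {}"
  obtains g where "g \<in> M" "accuracy n a g = best_accuracy n a M"
proof -
  have "best_accuracy n a M \<in> accuracy n a ` M"
    unfolding best_accuracy_def using assms by (intro Max_in) auto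
  then show ?thesis
    using that by force
qed

lemma accuracy_in_unit:
  assumes "n \<ge> 1" "\<forall>i\<in>{1..n}. a i g \<in> {0, 1}"
  shows "accuracy n a g \<in> {0..1}"
proof -
  have "(\<Sum>i=1..n. real (a i g)) \<le> (\<Sum>i=1..n. 1)"
    using assms(2) by (intro sum_mono) fastforce
  then show ?thesis
    using assms(1) by (auto simp: accuracy_def sum_nonneg)
qed

lemma successes_le_executions:
  assumes "\<forall>g\<in>M. a i g \<in> {0, 1}"
  shows "successes a M m i \<le> executions M m"
  unfolding successes_def executions_def using assms by (intro sum_mono) fastforce

text \<open>Entries vanish outside \<open>M\<close>, so a nonzero entry is counted by the sum. This
  keeps the ratio \<open>r / k\<close> meaningful and places \<open>k\<close> in the range where
  recovery curves are constrained.\<close>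

lemma executions_pos:
  assumes "finite M" "m \<in> portfolios M K" "m \<noteq> (\<lambda>_. 0)"
  shows "executions M m \<ge> 1"
proof -
  obtain g where "m g \<noteq> 0"
    using assms(3) by auto
  then have "g \<in> M" "1 \<le> m g"
    using assms(2) by (auto simp: portfolios_def)
  then show ?thesis
    using member_le_sum[of g M m] assms(1) by (simp add: executions_def)
qed

text \<open>The sums over tasks and workflows are exchanged; \<open>m g\<close> does not depend on
  the task and factors out.\<close>

lemma mean_successes:
  "(1 / real n) * (\<Sum>i=1..n. real (successes a M m i)) = (\<Sum>g\<in>M. real (m g) * accuracy n a g)"
proof -
  have "(\<Sum>i=1..n. real (successes a M m i)) = (\<Sum>g\<in>M. \<Sum>i=1..n. real (a i g) * real (m g))"
    unfolding successes_def by (simp add: sum.swap[of _ M])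
  then show ?thesis
    by (simp add: accuracy_def sum_distrib_left sum_distrib_right mult_ac)
qed

lemma mean_successes_le:
  assumes "finite M"
  shows "(1 / real n) * (\<Sum>i=1..n. real (successes a M m i))
       \<le> real (executions M m) * best_accuracy n a M"
  unfolding mean_successes executions_def of_nat_sum sum_distrib_right
  using assms by (intro sum_mono mult_left_mono accuracy_le_best) auto

text \<open>A Jensen inequality combined with monotonicity, both read off the single tangent at the
  best accuracy. The function \<open>f\<close> stands for the recovery curve at the fixed number of
  executions.\<close>

lemma mean_recovery_le_envelope:
  assumes "n \<ge> 1" "finite M" and a01: "\<forall>i\<in>{1..n}. \<forall>g\<in>M. a i g \<in> {0, 1}"
    and k: "executions M m \<ge> 1"
    and bound: "\<And>r. r \<le> executions M m \<Longrightarrow>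
      f r \<le> envelope \<Lambda> (real r / real (executions M m))"
    and "\<Lambda> \<ge> 1" and b: "best_accuracy n a M \<ge> 0"
  shows "(1 / real n) * (\<Sum>i=1..n. f (successes a M m i)) \<le> envelope \<Lambda> (best_accuracy n a M)"
proof -
  define k where "k = executions M m"
  define b where "b = best_accuracy n a M"
  define t where "t = \<Lambda> / (1 + (\<Lambda> - 1) * b)\<^sup>2"
  have t: "t \<ge> 0"
    using \<open>\<Lambda> \<ge> 1\<close> by (simp add: t_def)
  have "f (successes a M m i) \<le> envelope \<Lambda> b + t * (real (successes a M m i) / real k - b)"
    if "i \<in> {1..n}" for i
  proof -
    have "f (successes a M m i) \<le> envelope \<Lambda> (real (successes a M m i) / real k)"
      unfolding k_def using a01 that by (intro bound successes_le_executions) auto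
    also have "\<dots> \<le> envelope \<Lambda> b + t * (real (successes a M m i) / real k - b)"
      unfolding t_def using assms(6) b by (intro envelope_tangent) (auto simp: b_def)
    finally show ?thesis .
  qed
  then have "(\<Sum>i=1..n. f (successes a M m i))
      \<le> (\<Sum>i=1..n. envelope \<Lambda> b + t * (real (successes a M m i) / real k - b))"
    by (rule sum_mono)
  \<comment> \<open>The tangent bound is affine in the success counts, so only their sum
    survives.\<close>
  also have "\<dots> = real n * (envelope \<Lambda> b - t * b)
      + t / real k * (\<Sum>i=1..n. real (successes a M m i))"
    by (simp add: sum.distrib sum_distrib_left sum_subtractf algebra_simps)
  finally have "(1 / real n) * (\<Sum>i=1..n. f (successes a M m i))
      \<le> (1 / real n) * (real n * (envelope \<Lambda> b - t * b)
      + t / real k * (\<Sum>i=1..n. real (successes a M m i)))"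
    by (rule mult_left_mono) simp
  also have "\<dots> = envelope \<Lambda> b - t * b
      + t / real k * ((1 / real n) * (\<Sum>i=1..n. real (successes a M m i)))"
    using \<open>n \<ge> 1\<close> by (simp add: field_simps)
  \<comment> \<open>Since the slope \<open>t\<close> is nonnegative, the mean success count may be
    replaced by its upper bound \<open>k * b\<close>; the two terms in \<open>t * b\<close> then
    cancel.\<close>
  also have "\<dots> \<le> envelope \<Lambda> b - t * b + t / real k * (real k * b)"
    using t mean_successes_le[OF \<open>finite M\<close>, of n a m]
    by (intro add_left_mono mult_left_mono) (auto simp: k_def b_def)
  also have "\<dots> = envelope \<Lambda> b"
    using k by (simp add: k_def)
  finally show ?thesis
    by (simp add: b_def)
qed

text \<open>With one execution the success count is 0 or 1, and the boundary values of
  \<open>\<psi> 1\<close> make it the identity there. The mean recovery is therefore the mean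
  success count.\<close>

lemma single_execution_payoff:
  assumes "finite M" "K \<ge> 1" "recovery_curves K \<psi>"
    and a01: "\<forall>i\<in>{1..n}. \<forall>g\<in>M. a i g \<in> {0, 1}"
    and m: "executions M m = 1"
  shows "payoff n a c M \<psi> \<gamma> m
       = (\<Sum>g\<in>M. real (m g) * accuracy n a g) - \<gamma> * total_cost c M m"
proof -
  have "m \<noteq> (\<lambda>_. 0)"
    using m by (auto simp: executions_def)
  moreover have "\<psi> 1 (successes a M m i) = real (successes a M m i)" if "i \<in> {1..n}" for i
  proof -
    have "successes a M m i \<le> 1"
      using successes_le_executions[of M a i m] a01 that m by simp
    then have "successes a M m i = 0 \<or> successes a M m i = 1"
      by auto
    moreover have "\<psi> 1 0 = 0" "\<psi> 1 1 = 1"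
      using assms(2,3) by (auto simp: recovery_curves_def)
    ultimately show ?thesis
      by auto
  qed
  moreover from this have "(\<Sum>i=1..n. \<psi> 1 (successes a M m i)) = (\<Sum>i=1..n. real (successes a M m i))"
    by (intro sum.cong) auto
  ultimately show ?thesis
    by (simp add: payoff_def m mean_successes[symmetric])
qed

lemma total_cost_const:
  assumes "\<forall>g\<in>M. c g = c0"
  shows "total_cost c M m = c0 * real (executions M m)"
  using assms by (simp add: total_cost_def executions_def sum_distrib_left)

section \<open>The gain bound and the optimality of a singleton under equal costs\<close>

theorem corollary1:
  fixes n Kmax :: nat
    and M :: "'g set"
    and a :: "nat \<Rightarrow> 'g \<Rightarrow> nat"
    and c :: "'g \<Rightarrow> real"
    and \<gamma> \<Lambda> :: real
    and \<psi> :: "nat \<Rightarrow> nat \<Rightarrow> real"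
    and H :: "real \<Rightarrow> real"
  assumes "n \<ge> 1" and "Kmax \<ge> 1"
    and "finite M" and "M \<noteq> {}"
    and "\<forall>i\<in>{1..n}. \<forall>g\<in>M. a i g \<in> {0, 1}"
    and "\<forall>g\<in>M. c g \<ge> 0" and "\<gamma> \<ge> 0"
    and "recovery_curves Kmax \<psi>"
    and "H \<in> {0..1} \<rightarrow> {0..1}" and "H 0 = 0" and "H 1 = 1"
    and "\<forall>k\<in>{1..Kmax}. \<forall>r\<in>{0..k}. \<psi> k r \<le> H (real r / real k)"
    and "odds_lift H \<le> ereal \<Lambda>" and "\<Lambda> \<ge> 1"
  defines "a_star \<equiv> best_accuracy n a M"
  shows
    "(\<gamma> = 0 \<longrightarrow>
        opt_payoff n a c M Kmax \<psi> \<gamma> - a_star \<le> envelope \<Lambda> a_star - a_star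
      \<and> envelope \<Lambda> a_star - a_star
          = (\<Lambda> - 1) * a_star * (1 - a_star) / (1 + (\<Lambda> - 1) * a_star)
      \<and> (\<Lambda> - 1) * a_star * (1 - a_star) / (1 + (\<Lambda> - 1) * a_star)
          \<le> (sqrt \<Lambda> - 1) / (sqrt \<Lambda> + 1))
   \<and> (\<forall>c0. (\<forall>g\<in>M. c g = c0) \<and> \<gamma> * c0 \<ge> envelope \<Lambda> a_star - a_star \<longrightarrow>
        (\<exists>s. executions M s = 1
           \<and> is_arg_max (payoff n a c M \<psi> \<gamma>) (\<lambda>m. m \<in> portfolios M Kmax \<and> m \<noteq> (\<lambda>_. 0)) s
           \<and> (is_arg_max (payoff n a c M \<psi> \<gamma>) (\<lambda>m. m \<in> portfolios M Kmax) s
              \<or> is_arg_max (payoff n a c M \<psi> \<gamma>) (\<lambda>m. m \<in> portfolios M Kmax) (\<lambda>_. 0))))"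
proof -
  define h where "h = envelope \<Lambda> a_star"
  obtain g where g: "g \<in> M" "accuracy n a g = a_star"
    unfolding a_star_def using best_accuracy_attained[OF assms(3,4)] by metis
  have star: "a_star \<in> {0..1}"
    using accuracy_in_unit[of n a g] g assms(1,5) by auto
  have gain: "a_star \<le> h"
    unfolding h_def using assms(14) star by (rule envelope_ge)
  \<comment> \<open>Both claims rest on this bound: the cost is kept apart from the mean recovery,
    so it can be set to zero or priced against the gain.\<close>
  have bound: "payoff n a c M \<psi> \<gamma> m \<le> h - \<gamma> * total_cost c M m"
    if m: "m \<in> portfolios M Kmax" "m \<noteq> (\<lambda>_. 0)" for m
  proof -
    define k where "k = executions M m"
    have k: "k \<ge> 1" "k \<le> Kmax"
      using executions_pos[OF assms(3) m] m(1) by (auto simp: k_def portfolios_def)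
    have "\<psi> k r \<le> envelope \<Lambda> (real r / real k)" if "r \<le> k" for r
    proof -
      have "\<psi> k r \<le> H (real r / real k)"
        using assms(12) k that by auto
      also have "\<dots> \<le> envelope \<Lambda> (real r / real k)"
        using k that by (intro odds_lift_le_envelope assms(9-11,13,14)) auto
      finally show ?thesis .
    qed
    then have "(1 / real n) * (\<Sum>i=1..n. \<psi> k (successes a M m i)) \<le> h"
      unfolding h_def a_star_def
      using k star assms(1,3,5,14)
      by (intro mean_recovery_le_envelope) (auto simp: k_def a_star_def)
    then show ?thesis
      using m by (simp add: payoff_def k_def)
  qed
  have "opt_payoff n a c M Kmax \<psi> \<gamma> \<le> h" if "\<gamma> = 0"
  proof -
    \<comment> \<open>The zero portfolio is treated separately: its payoff 0 is at most
      \<open>h\<close> because \<open>0 \<le> a_star \<le> h\<close>.\<close>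
    have "payoff n a c M \<psi> \<gamma> m \<le> h" if "m \<in> portfolios M Kmax" for m
      using bound[OF that] gain star \<open>\<gamma> = 0\<close> by (cases "m = (\<lambda>_. 0)") (auto simp: payoff_def)
    then show ?thesis
      unfolding opt_payoff_def
      using finite_portfolios[OF assms(3), of Kmax] zero_in_portfolios[of M Kmax]
      by (subst Max_le_iff) auto
  qed
  moreover have "envelope \<Lambda> a_star - a_star
          = (\<Lambda> - 1) * a_star * (1 - a_star) / (1 + (\<Lambda> - 1) * a_star)"
    using assms(14) star by (intro envelope_gain) auto
  moreover have "(\<Lambda> - 1) * a_star * (1 - a_star) / (1 + (\<Lambda> - 1) * a_star)
          \<le> (sqrt \<Lambda> - 1) / (sqrt \<Lambda> + 1)"
    using assms(14) star by (intro envelope_gain_le) auto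
  moreover have "\<exists>s. executions M s = 1
           \<and> is_arg_max (payoff n a c M \<psi> \<gamma>) (\<lambda>m. m \<in> portfolios M Kmax \<and> m \<noteq> (\<lambda>_. 0)) s
           \<and> (is_arg_max (payoff n a c M \<psi> \<gamma>) (\<lambda>m. m \<in> portfolios M Kmax) s
              \<or> is_arg_max (payoff n a c M \<psi> \<gamma>) (\<lambda>m. m \<in> portfolios M Kmax) (\<lambda>_. 0))"
    if c0: "\<forall>g\<in>M. c g = c0" and price: "\<gamma> * c0 \<ge> h - a_star" for c0
  proof -
    \<comment> \<open>The witness is one execution of a workflow attaining the best
      accuracy.\<close>
    define s where "s = (\<lambda>x. if x = g then 1 else 0 :: nat)"
    have s1: "executions M s = 1"
      using g(1) assms(3) by (simp add: executions_def s_def)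
    have s: "s \<in> portfolios M Kmax" "s \<noteq> (\<lambda>_. 0)"
      using s1 g(1) assms(2) by (auto simp: portfolios_def s_def fun_eq_iff)
    have cost: "\<gamma> * total_cost c M m = \<gamma> * c0 * real (executions M m)" for m
      by (simp add: total_cost_const[OF c0])
    have "(\<Sum>x\<in>M. real (s x) * accuracy n a x) = (\<Sum>x\<in>M. if x = g then accuracy n a x else 0)"
      by (intro sum.cong) (auto simp: s_def)
    also have "\<dots> = a_star"
      using g assms(3) by simp
    finally have pay_s: "payoff n a c M \<psi> \<gamma> s = a_star - \<gamma> * c0"
      using single_execution_payoff[OF assms(3,2,8,5) s1, of c \<gamma>] cost[of s] s1 by simp
    \<comment> \<open>Portfolios with one execution cost the same as \<open>s\<close>, so accuracy
      alone decides. From two executions on, the payoff is at most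
      \<open>h - 2 * \<gamma> * c0\<close>, and the price condition brings this below
      \<open>a_star - \<gamma> * c0\<close>.\<close>
    have le: "payoff n a c M \<psi> \<gamma> m \<le> payoff n a c M \<psi> \<gamma> s"
      if m: "m \<in> portfolios M Kmax" "m \<noteq> (\<lambda>_. 0)" for m
    proof (cases "executions M m = 1")
      case True
      have "(\<Sum>x\<in>M. real (m x) * accuracy n a x) \<le> real (executions M m) * a_star"
        using mean_successes_le[OF assms(3), of n a m]
        unfolding mean_successes a_star_def .
      then show ?thesis
        using single_execution_payoff[OF assms(3,2,8,5) True, of c \<gamma>] cost[of m] True pay_s
        by simp
    next
      case False
      then have "executions M m \<ge> 2"
        using executions_pos[OF assms(3) m] by linarith
      \<comment> \<open>Monotonicity in the number of executions requires
        \<open>\<gamma> * c0 \<ge> 0\<close>, which follows from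
        \<open>\<gamma> * c0 \<ge> h - a_star \<ge> 0\<close>.\<close>
      then have "\<gamma> * c0 * 2 \<le> \<gamma> * total_cost c M m"
        unfolding cost using price gain by (intro mult_left_mono) auto
      then show ?thesis
        using bound[OF m] pay_s price by linarith
    qed
    have zero: "payoff n a c M \<psi> \<gamma> (\<lambda>_. 0) = 0"
      by (simp add: payoff_def)
    have "is_arg_max (payoff n a c M \<psi> \<gamma>) (\<lambda>m. m \<in> portfolios M Kmax \<and> m \<noteq> (\<lambda>_. 0)) s"
      using s le by (auto simp: is_arg_max_linorder)
    \<comment> \<open>Only the zero portfolio is added, with payoff 0, so the sign of the payoff of
      \<open>s\<close> decides which of the two is optimal.\<close>
    moreover have "is_arg_max (payoff n a c M \<psi> \<gamma>) (\<lambda>m. m \<in> portfolios M Kmax) s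
              \<or> is_arg_max (payoff n a c M \<psi> \<gamma>) (\<lambda>m. m \<in> portfolios M Kmax) (\<lambda>_. 0)"
    proof (cases "payoff n a c M \<psi> \<gamma> s \<ge> 0")
      case True
      then have "payoff n a c M \<psi> \<gamma> m \<le> payoff n a c M \<psi> \<gamma> s" if "m \<in> portfolios M Kmax" for m
        using le[OF that] zero by (cases "m = (\<lambda>_. 0)") auto
      then show ?thesis
        using s by (auto simp: is_arg_max_linorder)
    next
      case False
      then have "payoff n a c M \<psi> \<gamma> m \<le> payoff n a c M \<psi> \<gamma> (\<lambda>_. 0)"
        if "m \<in> portfolios M Kmax" for m
        using le[OF that] zero by (cases "m = (\<lambda>_. 0)") auto
      then show ?thesis
        using zero_in_portfolios[of M Kmax] by (auto simp: is_arg_max_linorder)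
    qed
    ultimately show ?thesis
      using s1 by blast
  qed
  ultimately show ?thesis
    unfolding h_def by fastforce
qed

end
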